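(* Let $q$ be an odd prime power and let $\gamma\in\mathbb{F}_{q^2}$. If $\mathrm{char}(\mathbb{F}_{q^2})\neq3$, the polynomial $f(x)=x+\gamma\,\mathrm{Tr}\left(x^4-x^{q+3}\right)$ over $\mathbb{F}_{q^2}$ is a permutation polynomial if and only if $\gamma=0$. If $\mathrm{char}(\mathbb{F}_{q^2})=3$, the polynomial $f(x)=x+\gamma\,\mathrm{Tr}\left(x^4-x^{q+3}\right)$ over $\mathbb{F}_{q^2}$ is a permutation polynomial if and only if $\gamma\in\mathbb{F}_q$.
   Context: $\mathrm{Tr}:\mathbb{F}_{q^2}\to\mathbb{F}_q$ is the trace map $\mathrm{Tr}(x)=x+x^q$. A polynomial $f$ over $\mathbb{F}_{q^2}$ is a permutation polynomial if the map $x\mapsto f(x)$ is a bijection of $\mathbb{F}_{q^2}$ onto itself. $\mathrm{char}(\mathbb{F}_{q^2})$ is the characteristic of $\mathbb{F}_{q^2}$. *)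

theory Defs
  imports "HOL-Number_Theory.Number_Theory" "HOL-Computational_Algebra.Polynomial"
    "HOL-Library.Cardinality"
begin

text \<open>
  The field \<open>\<bbbF>\<^bsub>q\<^sup>2\<^esub>\<close> is a type of class \<^class>\<open>finite_field\<close> with \<open>q\<^sup>2\<close> elements. Inside it, \<open>\<bbbF>\<^sub>q\<close>
  consists of the elements fixed by \<open>x \<mapsto> x ^ q\<close>; \<open>is_subfield_Fq\<close>, \<open>card_Fq\<close> and \<open>Fq_unique\<close> below
  show that this is the only subfield with \<open>q\<close> elements.
\<close>

definition Fq :: "nat \<Rightarrow> 'a::finite_field set" where
  "Fq q = {x. x ^ q = x}"

text \<open>
  The carrier is a general semiring, so that \<open>Tr q\<close> can be applied to elements of \<open>\<bbbF>\<^bsub>q\<^sup>2\<^esub>\<close> as well as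
  to polynomials over it; by \<open>poly_Tr\<close> below, the two uses agree under evaluation.
\<close>

definition Tr :: "nat \<Rightarrow> 'a::comm_semiring_1 \<Rightarrow> 'a" where
  "Tr q x = x + x ^ q"

definition permutation_polynomial :: "'a::finite_field poly \<Rightarrow> bool" where
  "permutation_polynomial f \<longleftrightarrow> bij (poly f)"

lemma poly_Tr: "poly (Tr q g) x = Tr q (poly g x)"
  by (simp add: Tr_def)


definition is_subfield :: "'a::field set \<Rightarrow> bool" where
  "is_subfield K \<longleftrightarrow> 0 \<in> K \<and> 1 \<in> K \<and> (\<forall>x\<in>K. \<forall>y\<in>K. x - y \<in> K \<and> x * y \<in> K) \<and> (\<forall>x\<in>K. inverse x \<in> K)"

lemma power_q_add:
  fixes x y :: "'a::finite_field"
  assumes "primepow q" and "CARD('a) = q ^ 2"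
  shows "(x + y) ^ q = x ^ q + y ^ q"
proof -
  obtain p k where pk: "prime p" "q = p ^ k" "k > 0"
    using assms(1) by (auto simp: primepow_def)
  have "CHAR('a) dvd p ^ (k * 2)"
    using CHAR_dvd_CARD[where ?'a = 'a] assms(2) pk by (simp add: power_mult)
  hence "CHAR('a) dvd p"
    using CHAR_prime[where ?'a = 'a] prime_dvd_power by blast
  hence "p = CHAR('a)"
    using pk(1) CHAR_prime[where ?'a = 'a] primes_dvd_imp_eq by metis
  thus ?thesis
    using freshmans_dream'[where ?'a = 'a and m = q and n = k and x = x and y = y] pk by simp
qed

lemma Tr_in_Fq:
  fixes x :: "'a::finite_field"
  assumes "primepow q" and "CARD('a) = q ^ 2"
  shows "Tr q x \<in> Fq q"
proof -
  have "(x ^ q) ^ q = x"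
    using finite_field_power_card_eq_same[of x] assms(2)
    by (simp add: power2_eq_square power_mult)
  thus ?thesis
    using power_q_add[OF assms, of x "x ^ q"] by (simp add: Fq_def Tr_def add.commute)
qed

lemma card_monom_roots_le:
  fixes a b :: "'a::finite_field"
  assumes "q > 1"
  shows "card {x. x ^ q + a * x = b} \<le> q"
proof -
  define P where "P = monom 1 q + [:-b, a:]"
  have deg: "degree P = q"
    unfolding P_def using assms
    by (subst degree_add_eq_left) (auto simp: degree_monom_eq)
  hence "P \<noteq> 0" using assms by auto
  hence "card {x. poly P x = 0} \<le> q"
    using card_poly_roots_bound[of P] deg by simp
  moreover have "{x. poly P x = 0} = {x. x ^ q + a * x = b}"
    by (auto simp: P_def poly_monom algebra_simps)
  ultimately show ?thesis by simp
qed

lemma card_Fq: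
  assumes "primepow q" and "CARD('a::finite_field) = q ^ 2"
  shows "card (Fq q :: 'a set) = q"
proof (rule antisym)
  have q: "q > 1"
    using assms(1) primepow_gt_Suc_0 by auto
  show "card (Fq q :: 'a set) \<le> q"
    using card_monom_roots_le[OF q, of "-1 :: 'a" 0] by (simp add: Fq_def)
  have "(UNIV :: 'a set) = (\<Union>y\<in>Fq q. {x. x ^ q + 1 * x = y})"
    using Tr_in_Fq[OF assms] by (auto simp: Tr_def add.commute)
  hence "CARD('a) \<le> (\<Sum>y\<in>(Fq q :: 'a set). card {x. x ^ q + 1 * x = y})"
    using card_UN_le[of "Fq q" "\<lambda>y. {x :: 'a. x ^ q + 1 * x = y}"] by simp
  also have "\<dots> \<le> (\<Sum>y\<in>(Fq q :: 'a set). q)"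
    by (intro sum_mono card_monom_roots_le[OF q])
  finally show "q \<le> card (Fq q :: 'a set)"
    using assms(2) q by (simp add: power2_eq_square)
qed

lemma is_subfield_Fq:
  assumes "primepow q" and "CARD('a::finite_field) = q ^ 2"
  shows "is_subfield (Fq q :: 'a set)"
proof -
  have "q > 0"
    using assms(1) primepow_gt_Suc_0 by fastforce
  moreover have "(x - y) ^ q = x - y" if "x ^ q = x" "y ^ q = y" for x y :: 'a
    using power_q_add[OF assms, of "x - y" y] that by (simp add: eq_diff_eq)
  ultimately show ?thesis
    by (auto simp: is_subfield_def Fq_def power_mult_distrib power_inverse)
qed

lemma Fq_unique:
  fixes K :: "'a::finite_field set"
  assumes "primepow q" and "CARD('a) = q ^ 2" and "is_subfield K" and "card K = q"
  shows "K = Fq q"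
proof -
  have q: "q > 0"
    using assms(1) primepow_gt_Suc_0 by fastforce
  have "x ^ q = x" if "x \<in> K" for x
  proof (cases "x = 0")
    case False
    let ?U = "K - {0}"
    have "inverse x * y \<in> K" if "y \<in> K" for y
      using assms(3) that \<open>x \<in> K\<close> by (auto simp: is_subfield_def)
    hence "bij_betw ((*) x) ?U ?U"
      using assms(3) that False
      by (intro bij_betwI[where g = "(*) (inverse x)"])
         (auto simp: is_subfield_def simp flip: mult.assoc)
    hence "(\<Prod>y\<in>?U. y) = (\<Prod>y\<in>?U. x * y)"
      by (rule prod.reindex_bij_betw [symmetric])
    also have "\<dots> = x ^ card ?U * (\<Prod>y\<in>?U. y)"
      by (simp add: prod.distrib)
    finally have "x ^ card ?U = 1"
      by simp
    moreover have "card ?U = q - 1"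
      using assms(3,4) by (simp add: is_subfield_def)
    ultimately show ?thesis
      using q by (metis mult.right_neutral power_minus_mult mult.commute)
  qed (use q in simp)
  hence "K \<subseteq> Fq q"
    by (auto simp: Fq_def)
  thus ?thesis
    using card_Fq[OF assms(1,2)] assms(4) by (intro card_subset_eq) auto
qed

end

theory Submission
  imports Defs
begin

text \<open>
  With \<open>y = x\<^sup>q\<close> one has \<open>Tr(x\<^sup>4 - x\<^bsup>q+3\<^esup>) = (x - y)\<^sup>2 (x\<^sup>2 + x y + y\<^sup>2)\<close>, which vanishes on \<open>\<bbbF>\<^sub>q\<close>.

  If \<open>\<gamma> \<in> \<bbbF>\<^sub>q\<close>, then \<open>f\<close> preserves \<open>x - y\<close>. In characteristic 3 the trace is \<open>(x - y)\<^sup>4\<close>, so \<open>f\<close> is a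
  translation on each fibre of \<open>x - y\<close>; in other characteristics, \<open>f\<close> is for \<open>\<gamma> \<noteq> 0\<close>
  quadratic, hence not injective, on every fibre but \<open>\<bbbF>\<^sub>q\<close>.

  If \<open>\<gamma> \<notin> \<bbbF>\<^sub>q\<close>, write \<open>x = a + s \<gamma>\<close> with \<open>a, s \<in> \<bbbF>\<^sub>q\<close>: a collision \<open>f(x) = f(a) = a\<close> with \<open>s \<noteq> 0\<close> amounts
  to a quadratic equation for \<open>a\<close> whose discriminant is, for \<open>s = 1/r\<close> and up to a square factor,
  \<open>-3 E (4 r\<^sup>3 + E\<^sup>2)\<close>, where \<open>E = (\<gamma> - \<gamma>\<^sup>q)\<^sup>2\<close> is a nonsquare of \<open>\<bbbF>\<^sub>q\<close>. If \<open>-E\<^sup>2/4\<close> is a cube, some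
  \<open>r\<close> makes this zero (in characteristic 3, \<open>a\<close> drops out of the equation, which then just says that
  \<open>r\<^sup>3 = -E\<^sup>2\<close>, and everything is a cube). Otherwise \<open>-3\<close> is a square, and if no \<open>r\<close> worked, \<open>r\<^sup>3 + E\<^sup>2/4\<close> would be a nonzero
  square for every \<open>r\<close>. By homogeneity, the sum of the quadratic character over \<open>W + A\<close>, where \<open>W\<close> is the
  set of cubes, would then be \<open>\<plusminus>|W|\<close> for a third of all \<open>A\<close>, which is incompatible with the second
  moment \<open>q |W| - |W|\<^sup>2\<close> of these sums.
\<close>

section \<open>Counting roots and power images\<close>

lemma card_power_eq_le:
  fixes c :: "'a::finite_field"
  assumes "n > 0"
  shows "card {x. x ^ n = c} \<le> n"
proof -
  define P where "P = monom 1 n + [:-c:]"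
  have deg: "degree P = n"
    unfolding P_def using assms
    by (subst degree_add_eq_left) (auto simp: degree_monom_eq)
  hence "P \<noteq> 0" using assms by auto
  hence "card {x. poly P x = 0} \<le> n"
    using card_poly_roots_bound[of P] deg by simp
  moreover have "{x. poly P x = 0} = {x. x ^ n = c}"
    by (auto simp: P_def poly_monom)
  ultimately show ?thesis by simp
qed

lemma card_le_mult_card_power_image:
  fixes A :: "'a::finite_field set"
  assumes "n > 0"
  shows "card A \<le> n * card ((\<lambda>x. x ^ n) ` A)"
proof -
  have "card A = (\<Sum>y\<in>(\<lambda>x. x ^ n) ` A. \<Sum>x\<in>{x\<in>A. x ^ n = y}. 1)"
    using sum.image_gen[of A "\<lambda>_. 1::nat" "\<lambda>x. x ^ n"] by simp
  also have "\<dots> \<le> (\<Sum>y\<in>(\<lambda>x. x ^ n) ` A. n)"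
  proof (rule sum_mono)
    fix y
    have "card {x\<in>A. x ^ n = y} \<le> card {x. x ^ n = y}"
      by (intro card_mono) auto
    thus "(\<Sum>x\<in>{x\<in>A. x ^ n = y}. 1) \<le> n"
      using card_power_eq_le[OF assms, of y] by simp
  qed
  finally show ?thesis by (simp add: mult.commute)
qed

text \<open>The quadratic character of \<open>\<bbbF>\<^sub>q\<close>; its values outside \<open>\<bbbF>\<^sub>q\<close> are meaningless.\<close>

definition quad_char :: "nat \<Rightarrow> 'a::finite_field \<Rightarrow> int" where
  "quad_char q x = (if x = 0 then 0 else if x ^ ((q - 1) div 2) = 1 then 1 else -1)"

lemma quad_char_0 [simp]: "quad_char q 0 = 0"
  by (simp add: quad_char_def)

lemma quad_char_1 [simp]: "quad_char q 1 = 1"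
  by (simp add: quad_char_def)

lemma quad_char_eq_0_iff [simp]: "quad_char q x = 0 \<longleftrightarrow> x = 0"
  by (simp add: quad_char_def)

lemma quad_char_cases: "x \<noteq> 0 \<Longrightarrow> quad_char q x = 1 \<or> quad_char q x = -1"
  by (simp add: quad_char_def)

lemma quad_char_square_self: "quad_char q x * quad_char q x = (if x = 0 then 0 else 1)"
  by (simp add: quad_char_def)

section \<open>Arithmetic of \<gamma>'s ambient field: the subfield \<open>Fq q\<close> and
  conjugation x -> x^q\<close>

context
  fixes q :: nat
  assumes q: "primepow q" "odd q" and card_q2: "CARD('a::finite_field) = q ^ 2"
begin

abbreviation K :: "'a set" where "K \<equiv> Fq q"

abbreviation \<chi> :: "'a \<Rightarrow> int" where "\<chi> \<equiv> quad_char q"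

lemma q_gt_1: "q > 1"
  using q primepow_gt_Suc_0 by auto

lemma two_neq_0: "(2::'a) \<noteq> 0"
proof
  assume "(2::'a) = 0"
  hence "CHAR('a) dvd 2"
    using of_nat_eq_0_iff_char_dvd[of 2, where ?'a = 'a] by simp
  hence "CHAR('a) = 2"
    using CHAR_prime[where ?'a = 'a] two_is_prime_nat primes_dvd_imp_eq by blast
  thus False
    using CHAR_dvd_CARD[where ?'a = 'a] q card_q2 by simp
qed

lemma four_neq_0: "(4::'a) \<noteq> 0"
  using two_neq_0 by (metis mult_2 mult_eq_0_iff numeral_Bit0)

lemma K_0: "0 \<in> K" and K_1: "1 \<in> K"
  and K_diff: "x \<in> K \<Longrightarrow> y \<in> K \<Longrightarrow> x - y \<in> K"
  and K_mult: "x \<in> K \<Longrightarrow> y \<in> K \<Longrightarrow> x * y \<in> K"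
  and K_inverse: "x \<in> K \<Longrightarrow> inverse x \<in> K"
  using is_subfield_Fq[OF q(1) card_q2] by (auto simp: is_subfield_def)

lemma K_uminus: "x \<in> K \<Longrightarrow> - x \<in> K"
  using K_diff[OF K_0] by fastforce

lemma K_add: "x \<in> K \<Longrightarrow> y \<in> K \<Longrightarrow> x + y \<in> K"
  using K_diff[of x "- y"] K_uminus by simp

lemma K_divide: "x \<in> K \<Longrightarrow> y \<in> K \<Longrightarrow> x / y \<in> K"
  by (simp add: divide_inverse K_mult K_inverse)

lemma K_power: "x \<in> K \<Longrightarrow> x ^ n \<in> K"
  by (induction n) (auto simp: K_1 K_mult)

lemma K_of_nat: "of_nat n \<in> K"
  by (induction n) (auto simp: K_0 K_1 K_add)

lemma K_numeral: "numeral n \<in> K"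
  using K_of_nat[of "numeral n"] by simp

lemmas K_closed = K_0 K_1 K_diff K_mult K_inverse K_uminus K_add K_divide K_power K_numeral

lemma conj_add: "(x + y :: 'a) ^ q = x ^ q + y ^ q"
  by (rule power_q_add[OF q(1) card_q2])

lemma conj_diff: "(x - y :: 'a) ^ q = x ^ q - y ^ q"
  using conj_add[of "x - y" y] by (simp add: eq_diff_eq)

lemma conj_conj: "((x::'a) ^ q) ^ q = x"
  using finite_field_power_card_eq_same[of x] card_q2
  by (simp add: power2_eq_square power_mult)

lemma conj_K: "x \<in> K \<Longrightarrow> x ^ q = x"
  by (simp add: Fq_def)

lemma in_K_iff: "x \<in> K \<longleftrightarrow> x ^ q = x"
  by (simp add: Fq_def)

lemma power_q_minus_1:
  assumes "(x::'a) \<noteq> 0"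
  shows "x ^ (q - 1) = x ^ q / x"
  using assms q_gt_1 by (simp add: power_diff)

lemma two_mult_half: "(q - 1) div 2 * 2 = q - 1"
  using q q_gt_1 by simp

section \<open>Squares and the quadratic character\<close>

lemma power_half_cases:
  assumes "x \<in> K" "x \<noteq> 0"
  shows "x ^ ((q - 1) div 2) = 1 \<or> x ^ ((q - 1) div 2) = -1"
proof -
  have "(x ^ ((q - 1) div 2)) ^ 2 = 1"
    using assms power_q_minus_1[of x] conj_K[of x]
    by (simp only: power_mult[symmetric] two_mult_half) simp
  thus ?thesis by (simp add: power2_eq_1_iff)
qed

lemma quad_char_mult:
  assumes "x \<in> K" "y \<in> K"
  shows "\<chi> (x * y) = \<chi> x * \<chi> y"
proof (cases "x = 0 \<or> y = 0")
  case False
  moreover have "(-1::'a) \<noteq> 1" using two_neq_0 by (metis one_add_one add.right_inverse)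
  ultimately show ?thesis
    using power_half_cases[OF assms(1)] power_half_cases[OF assms(2)]
    by (auto simp: quad_char_def power_mult_distrib)
qed auto

lemma quad_char_square:
  assumes "y \<in> K" "y \<noteq> 0"
  shows "\<chi> (y ^ 2) = 1"
  using assms quad_char_mult[of y y] by (simp add: quad_char_square_self power2_eq_square)

text \<open>Counting: nonzero squares are roots of X^m - 1 with m = (q - 1)/2. Squaring is at most
  two-to-one, so there are at least m of them, and they exhaust the roots.\<close>

lemma square_if_quad_char:
  assumes "x \<in> K" "\<chi> x \<noteq> -1"
  shows "\<exists>y\<in>K. y ^ 2 = x"
proof (cases "x = 0")
  case True
  thus ?thesis using K_0 by (intro bexI[of _ 0]) auto
next
  case False
  let ?m = "(q - 1) div 2" and ?S = "(\<lambda>y. y ^ 2) ` (K - {0})"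
  have x: "x ^ ?m = 1"
    using assms False by (auto simp: quad_char_def split: if_splits)
  have m: "?m > 0" using two_mult_half q_gt_1 by (cases ?m) auto
  have sub: "?S \<subseteq> {x. x ^ ?m = 1}"
  proof safe
    fix y assume y: "y \<in> K" "y \<noteq> 0"
    hence "\<chi> (y ^ 2) = 1" by (rule quad_char_square)
    thus "(y ^ 2) ^ ?m = 1" by (auto simp: quad_char_def split: if_splits)
  qed
  have "card (K - {0}) = q - 1"
    using card_Fq[OF q(1) card_q2] K_0 by simp
  hence "?m \<le> card ?S"
    using card_le_mult_card_power_image[of 2 "K - {0}"] two_mult_half by linarith
  hence "card {x::'a. x ^ ?m = 1} \<le> card ?S"
    using card_power_eq_le[OF m, of "1::'a"] by linarith
  hence "?S = {x. x ^ ?m = 1}"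
    using sub by (intro card_seteq) auto
  hence "x \<in> ?S" using x by blast
  thus ?thesis by auto
qed

lemma conj_diff_conj: "((z::'a) - z ^ q) ^ q = - (z - z ^ q)"
  by (simp add: conj_diff conj_conj)

text \<open>A source of nonsquares: raising \<theta>^2 to the power (q - 1)/2 gives \<theta>^q /
  \<theta> = -1.\<close>

lemma anti_square:
  assumes "(\<theta>::'a) ^ q = - \<theta>" "\<theta> \<noteq> 0"
  shows "\<theta> ^ 2 \<in> K" "\<chi> (\<theta> ^ 2) = -1"
proof -
  show "\<theta> ^ 2 \<in> K"
    using assms by (simp add: in_K_iff power_mult[symmetric] mult.commute[of 2])
      (simp add: power_mult)
  have "(\<theta> ^ 2) ^ ((q - 1) div 2) = \<theta> ^ (q - 1)"
    using two_mult_half by (simp only: power_mult[symmetric] mult.commute[of 2])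
  also have "\<dots> = -1" using power_q_minus_1[of \<theta>] assms by simp
  finally have "(\<theta> ^ 2) ^ ((q - 1) div 2) = -1" .
  moreover have "(-1::'a) \<noteq> 1" using two_neq_0 by (metis one_add_one add.right_inverse)
  ultimately show "\<chi> (\<theta> ^ 2) = -1" using assms by (simp add: quad_char_def)
qed

lemma exists_anti: "\<exists>\<theta>::'a. \<theta> ^ q = - \<theta> \<and> \<theta> \<noteq> 0"
proof -
  have "card K \<noteq> CARD('a)"
    using card_Fq[OF q(1) card_q2] card_q2 q_gt_1 by (simp add: power2_eq_square)
  hence "K \<noteq> UNIV" by metis
  then obtain z where "z \<notin> K" by auto
  hence "z - z ^ q \<noteq> 0" by (simp add: in_K_iff)
  thus ?thesis using conj_diff_conj[of z] by blast
qed

section \<open>Sums of the quadratic character\<close>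

lemma sum_quad_char: "(\<Sum>t\<in>K. \<chi> t) = 0"
proof -
  obtain \<theta> :: 'a where th: "\<theta> ^ q = - \<theta>" "\<theta> \<noteq> 0"
    using exists_anti by blast
  \<comment> \<open>Scaling by the nonsquare \<theta>^2 permutes \<open>K\<close> and flips every
    character value, so the sum equals its own negative.\<close>
  have bij: "bij_betw ((*) (\<theta> ^ 2)) K K"
    using th anti_square[OF th]
    by (intro bij_betwI[where g = "\<lambda>y. y / \<theta> ^ 2"]) (auto intro!: K_closed)
  have "(\<Sum>t\<in>K. \<chi> t) = (\<Sum>t\<in>K. \<chi> (\<theta> ^ 2 * t))"
    using sum.reindex_bij_betw[OF bij, of \<chi>] by simp
  also have "\<dots> = (\<Sum>t\<in>K. - \<chi> t)"
    using anti_square[OF th] by (intro sum.cong) (simp_all add: quad_char_mult)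
  finally show ?thesis by (simp add: sum_negf)
qed

text \<open>With B = w + A nonzero, the factor \<chi>(B)^2 = 1 splits off and \<chi>(1 + d/B)
  remains. Here 1 + d/B runs over all of \<open>K\<close> except 1, so the full sum 0 loses
  \<chi>(1) = 1.\<close>

lemma quad_char_correlation:
  assumes "w \<in> K" "v \<in> K" "w \<noteq> v"
  shows "(\<Sum>A\<in>K. \<chi> (w + A) * \<chi> (v + A)) = -1"
proof -
  define d where "d = v - w"
  have d: "d \<in> K" "d \<noteq> 0" using assms by (auto simp: d_def K_diff)
  have bij1: "bij_betw (\<lambda>B. B - w) K K"
    using assms by (intro bij_betwI[where g = "\<lambda>A. A + w"]) (auto intro: K_closed)
  have bij2: "bij_betw (\<lambda>B. 1 + d / B) (K - {0}) (K - {1})"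
    using d by (intro bij_betwI[where g = "\<lambda>t. d / (t - 1)"]) (auto intro!: K_closed)
  have "(\<Sum>A\<in>K. \<chi> (w + A) * \<chi> (v + A)) = (\<Sum>B\<in>K. \<chi> B * \<chi> (B + d))"
    using sum.reindex_bij_betw[OF bij1, of "\<lambda>A. \<chi> (w + A) * \<chi> (v + A)"]
    by (simp add: d_def algebra_simps)
  also have "\<dots> = (\<Sum>B\<in>K - {0}. \<chi> B * \<chi> (B + d))"
    by (intro sum.mono_neutral_right) auto
  also have "\<dots> = (\<Sum>B\<in>K - {0}. \<chi> (1 + d / B))"
  proof (intro sum.cong refl)
    fix B assume B: "B \<in> K - {0}"
    hence "B + d = B * (1 + d / B)" by (simp add: field_simps)
    hence "\<chi> (B + d) = \<chi> B * \<chi> (1 + d / B)"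
      using B d by (simp only:) (intro quad_char_mult; auto intro!: K_closed)
    thus "\<chi> B * \<chi> (B + d) = \<chi> (1 + d / B)"
      using B by (simp add: mult.assoc[symmetric] quad_char_square_self)
  qed
  also have "\<dots> = (\<Sum>t\<in>K - {1}. \<chi> t)"
    by (rule sum.reindex_bij_betw[OF bij2])
  also have "\<dots> = -1"
    using sum_quad_char K_1 by (simp add: sum_diff1)
  finally show ?thesis .
qed

text \<open>Expanding the square, each diagonal pair contributes q - 1 and each off-diagonal pair
  -1.\<close>

lemma quad_char_second_moment:
  assumes "W \<subseteq> K"
  shows "(\<Sum>A\<in>K. (\<Sum>w\<in>W. \<chi> (w + A)) ^ 2) = int q * int (card W) - int (card W) ^ 2"
proof -
  have diag: "(\<Sum>A\<in>K. \<chi> (w + A) * \<chi> (w + A)) = int q - 1" if "w \<in> K" for w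
  proof -
    have "(\<Sum>A\<in>K. \<chi> (w + A) * \<chi> (w + A)) = (\<Sum>A\<in>K - {-w}. 1)"
      using that K_uminus
      by (intro sum.mono_neutral_cong_right)
        (auto simp: quad_char_square_self eq_neg_iff_add_eq_0 add.commute)
    also have "\<dots> = int q - 1"
      using that K_uminus card_Fq[OF q(1) card_q2] q_gt_1 by simp
    finally show ?thesis .
  qed
  have "(\<Sum>A\<in>K. (\<Sum>w\<in>W. \<chi> (w + A)) ^ 2) = (\<Sum>A\<in>K. \<Sum>w\<in>W. \<Sum>v\<in>W. \<chi> (w + A) * \<chi> (v + A))"
    by (simp add: power2_eq_square sum_product)
  also have "\<dots> = (\<Sum>w\<in>W. \<Sum>v\<in>W. \<Sum>A\<in>K. \<chi> (w + A) * \<chi> (v + A))"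
    by (subst sum.swap) (intro sum.cong refl sum.swap)
  also have "\<dots> = (\<Sum>w\<in>W. \<Sum>v\<in>W. (if w = v then int q else 0) - 1)"
    using subsetD[OF assms] diag quad_char_correlation by (intro sum.cong refl) auto
  also have "\<dots> = (\<Sum>w\<in>W. int q - int (card W))"
    by (intro sum.cong) (simp_all add: sum_subtractf)
  finally show ?thesis by (simp add: algebra_simps power2_eq_square)
qed

lemma exists_cube_plus_not_square:
  assumes "q > 3" "A0 \<in> K" "\<chi> A0 = 1"
  shows "\<exists>r\<in>K. \<chi> (r ^ 3 + A0) \<noteq> 1"
proof (rule ccontr)
  assume "\<not> ?thesis"
  hence sq: "\<chi> (r ^ 3 + A0) = 1" if "r \<in> K" for r
    using that by blast
  define C W where "C = (\<lambda>x. x ^ 3) ` (K - {0})" and "W = (\<lambda>x. x ^ 3) ` K"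
  have "W = insert 0 C"
    unfolding C_def W_def using K_0 by (auto simp: image_iff)
  moreover have "0 \<notin> C" by (auto simp: C_def)
  ultimately have cardW: "card W = card C + 1" by simp
  have "card (K - {0}) = q - 1"
    using card_Fq[OF q(1) card_q2] K_0 by simp
  hence cardC: "q - 1 \<le> 3 * card C"
    using card_le_mult_card_power_image[of 3 "K - {0}"] by (simp add: C_def)
  have WK: "W \<subseteq> K" by (auto simp: W_def intro: K_closed)
  have A0: "A0 \<noteq> 0" using assms(3) by auto
  let ?T = "\<lambda>A. \<Sum>w\<in>W. \<chi> (w + A)"
  have T: "(?T (A0 * k)) ^ 2 = int (card W) ^ 2" if k: "k \<in> C" for k
  proof -
    obtain c where c: "c \<in> K" "c \<noteq> 0" "k = c ^ 3"
      using k by (auto simp: C_def)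
    have "\<chi> (w + A0 * k) = \<chi> (c ^ 3)" if "w \<in> W" for w
    proof -
      obtain r where r: "r \<in> K" "w = r ^ 3"
        using \<open>w \<in> W\<close> by (auto simp: W_def)
      \<comment> \<open>Homogeneity: pulling out c^3 leaves a cube plus \<open>A0\<close>, whose
        character is 1 by \<open>sq\<close>.\<close>
      have "w + A0 * k = c ^ 3 * ((r / c) ^ 3 + A0)"
        using c r by (simp add: field_simps)
      moreover have "\<chi> (c ^ 3 * ((r / c) ^ 3 + A0)) = \<chi> (c ^ 3) * \<chi> ((r / c) ^ 3 + A0)"
        using c r assms by (intro quad_char_mult) (auto intro!: K_closed)
      ultimately show ?thesis using sq[of "r / c"] c r by (simp add: K_divide)
    qed
    hence "?T (A0 * k) = int (card W) * \<chi> (c ^ 3)" by simp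
    thus ?thesis
      using quad_char_cases[of "c ^ 3" q] c by (auto simp: power_mult_distrib)
  qed
  have "int (card C) * int (card W) ^ 2 = (\<Sum>k\<in>C. (?T (A0 * k)) ^ 2)"
    using T by simp
  also have "\<dots> = (\<Sum>A\<in>(*) A0 ` C. (?T A) ^ 2)"
    using A0 by (subst sum.reindex) (auto simp: inj_on_def)
  also have "\<dots> \<le> (\<Sum>A\<in>K. (?T A) ^ 2)"
    using assms by (intro sum_mono2) (auto simp: C_def intro!: K_closed)
  also have "\<dots> = int q * int (card W) - int (card W) ^ 2"
    by (rule quad_char_second_moment[OF WK])
  finally have "int (card W) * (int (card C) * int (card W) + int (card W)) \<le> int (card W) * int q"
    by (simp add: algebra_simps power2_eq_square)
  hence "int (card C) * int (card W) + int (card W) \<le> int q"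
    using cardW by simp
  \<comment> \<open>Cubing is at most three-to-one, so q is at most 3|C| + 1, while |W| = |C| + 1.
    This forces |C| to be at most 1.\<close>
  hence "(int (card C) + 1) * (int (card C) + 1) \<le> 3 * int (card C) + 1"
    using cardW cardC by (simp add: algebra_simps)
  hence "int (card C) * int (card C) \<le> int (card C) * 1"
    by (simp add: algebra_simps)
  hence "card C \<le> 1"
    by (cases "card C = 0") simp_all
  hence "q \<le> 4" using cardC by simp
  thus False using assms(1) q(2) by (cases "q = 4") auto
qed

section \<open>The trace expression and its restriction to lines\<close>

definition trace_term :: "'a \<Rightarrow> 'a" where
  "trace_term x = (x - x ^ q) ^ 2 * (x ^ 2 + x * x ^ q + (x ^ q) ^ 2)"

text \<open>With y = x^q and y^q = x, the trace is x^4 - x^3 y + y^4 - x y^3 = (x - y)(x^3 -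
  y^3).\<close>

lemma poly_eq_trace_term:
  "poly (monom 1 1 + smult \<gamma> (Tr q (monom 1 4 - monom 1 (q + 3)))) x = x + \<gamma> * trace_term x"
proof -
  have "(x ^ 4) ^ q = (x ^ q) ^ 4"
    by (simp add: power_mult[symmetric] mult.commute)
  moreover have "(x ^ (q + 3)) ^ q = (x ^ q) ^ q * (x ^ q) ^ 3"
    by (simp add: power_mult[symmetric] power_add[symmetric] algebra_simps)
  hence "(x ^ (q + 3)) ^ q = x * (x ^ q) ^ 3"
    by (simp only: conj_conj)
  ultimately have "Tr q (x ^ 4 - x ^ (q + 3)) = trace_term x"
    by (simp add: Tr_def conj_diff trace_term_def power_add) (simp add: algebra_simps eval_nat_numeral)
  thus ?thesis by (simp add: poly_Tr poly_monom)
qed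

lemma trace_term_K:
  assumes "a \<in> K"
  shows "trace_term a = 0"
  using assms q_gt_1 by (simp add: trace_term_def conj_K)

text \<open>On this line x - x^q = s(\<gamma> - \<gamma>^q) is independent of \<open>a\<close>, so
  only the second factor of the trace varies with \<open>a\<close>.\<close>

lemma trace_term_line:
  assumes "a \<in> K" "s \<in> K"
  shows "trace_term (a + s * \<gamma>) = s ^ 2 * (\<gamma> - \<gamma> ^ q) ^ 2 *
    (3 * a ^ 2 + 3 * a * s * (\<gamma> + \<gamma> ^ q) + s ^ 2 * (\<gamma> ^ 2 + \<gamma> * \<gamma> ^ q + (\<gamma> ^ q) ^ 2))"
proof -
  have "(a + s * \<gamma>) ^ q = a + s * \<gamma> ^ q"
    using assms by (simp add: conj_add power_mult_distrib conj_K)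
  thus ?thesis by (simp add: trace_term_def) (simp add: algebra_simps eval_nat_numeral)
qed

section \<open>Collisions for \<gamma> outside the subfield\<close>

lemma not_inj_if_root:
  assumes "a \<in> K" "s \<in> K" "s \<noteq> 0" "\<gamma> \<noteq> 0" "s + trace_term (a + s * \<gamma>) = 0"
  shows "\<not> inj (\<lambda>x. x + \<gamma> * trace_term x)"
proof
  assume inj: "inj (\<lambda>x. x + \<gamma> * trace_term x)"
  \<comment> \<open>The image lies on the same line, and the root condition kills its
    \<gamma>-coordinate, leaving \<open>a\<close>, which is its own image.\<close>
  have "(a + s * \<gamma>) + \<gamma> * trace_term (a + s * \<gamma>) = a + \<gamma> * (s + trace_term (a + s * \<gamma>))"
    by (simp add: algebra_simps)
  also have "\<dots> = a + \<gamma> * trace_term a"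
    using assms by (simp add: trace_term_K)
  finally have "a + s * \<gamma> = a"
    by (rule injD[OF inj])
  thus False using assms by simp
qed

lemma not_inj_if_square:
  fixes \<gamma> :: 'a
  defines "E \<equiv> (\<gamma> - \<gamma> ^ q) ^ 2"
  assumes g: "\<gamma> \<notin> K" and three: "(3::'a) \<noteq> 0"
    and r: "r \<in> K" "r \<noteq> 0" and y: "y \<in> K" "y ^ 2 = -3 * E * (4 * r ^ 3 + E ^ 2)"
  shows "\<not> inj (\<lambda>x. x + \<gamma> * trace_term x)"
proof -
  define T where "T = \<gamma> + \<gamma> ^ q"
  define s where "s = 1 / r"
  \<comment> \<open>Chosen to solve 6sEa + 3s^2 ET = y s^2, the square root of the completed square
    below.\<close>
  define a where "a = (y * s ^ 2 - 3 * s ^ 2 * E * T) / (6 * s * E)"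
  have th: "\<gamma> - \<gamma> ^ q \<noteq> 0" using g by (simp add: in_K_iff)
  have E: "E \<in> K" "E \<noteq> 0"
    using anti_square(1)[OF conj_diff_conj th] th by (auto simp: E_def)
  have T: "T \<in> K" by (simp add: T_def in_K_iff conj_add conj_conj)
  have s: "s \<in> K" "s \<noteq> 0" using r by (auto simp: s_def intro!: K_closed)
  have a: "a \<in> K" unfolding a_def using s E T y(1) by (intro K_closed)
  have six: "(6::'a) \<noteq> 0"
    using two_neq_0 three by (metis mult_eq_0_iff numeral_times_numeral num_double)
  have nz: "6 * s * E \<noteq> 0" using six s E by simp
  have a6: "6 * s * E * a + 3 * s ^ 2 * E * T = y * s ^ 2"
    using nz by (simp add: a_def)
  have M: "4 * (\<gamma> ^ 2 + \<gamma> * \<gamma> ^ q + (\<gamma> ^ q) ^ 2) = 3 * T ^ 2 + E"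
    by (simp add: T_def E_def algebra_simps power2_eq_square)
  define M where "M = \<gamma> ^ 2 + \<gamma> * \<gamma> ^ q + (\<gamma> ^ q) ^ 2"
  note M = M[folded M_def]
  let ?R = "1 + s * E * (3 * a ^ 2 + 3 * a * s * T + s ^ 2 * M)"
  \<comment> \<open>Completing the square in \<open>a\<close>; the terms in T cancel because 4M =
    3T^2 + E.\<close>
  have "12 * s * E * ?R = (6 * s * E * a + 3 * s ^ 2 * E * T) ^ 2
      - 9 * s ^ 4 * E ^ 2 * T ^ 2 + 12 * s * E + 3 * s ^ 4 * E ^ 2 * (4 * M)"
    by (simp add: algebra_simps eval_nat_numeral)
  also have "\<dots> = y ^ 2 * s ^ 4 + 3 * E * (4 * s + s ^ 4 * E ^ 2)"
    unfolding a6 M by (simp add: algebra_simps eval_nat_numeral)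
  also have "\<dots> = 0"
    unfolding y(2) using r by (simp add: s_def field_simps eval_nat_numeral)
  finally have "12 * s * E * ?R = 0" .
  moreover have "12 * s * E = 2 * (6 * s * E)" by simp
  ultimately have R: "?R = 0" using nz two_neq_0 by (metis mult_eq_0_iff)
  have "s + trace_term (a + s * \<gamma>) = s * ?R"
    unfolding trace_term_line[OF a s(1)]
    by (simp add: T_def E_def M_def) (simp add: algebra_simps eval_nat_numeral)
  hence root: "s + trace_term (a + s * \<gamma>) = 0" using R by simp
  have "\<gamma> \<noteq> 0" using g K_0 by auto
  from not_inj_if_root[OF a s this root] show ?thesis .
qed

text \<open>If cubing is not injective on \<open>K\<close>, distinct x, y with equal cubes satisfy
  x^2 + xy + y^2 = 0, so (2x + y)^2 = -3y^2. In characteristic 3 this cannot happen, since (x - y)^3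
  = x^3 - y^3.\<close>

lemma cube_surj_or_minus_3_square:
  assumes "b \<in> K"
  shows "(\<exists>r\<in>K. r ^ 3 = b) \<or> (\<exists>y\<in>K. y ^ 2 = -3 \<and> (3::'a) \<noteq> 0)"
proof (cases "inj_on (\<lambda>x. x ^ 3) K")
  case True
  moreover have "(\<lambda>x. x ^ 3) ` K \<subseteq> K"
    by (intro image_subsetI K_power)
  ultimately have "(\<lambda>x. x ^ 3) ` K = K"
    by (intro endo_inj_surj) simp_all
  hence "b \<in> (\<lambda>x. x ^ 3) ` K" using assms by simp
  thus ?thesis by blast
next
  case False
  then obtain x y where xy: "x \<in> K" "y \<in> K" "x ^ 3 = y ^ 3" "x \<noteq> y"
    by (auto simp: inj_on_def)
  have "(x - y) * (x ^ 2 + x * y + y ^ 2) = 0"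
    using xy(3) by (simp add: algebra_simps eval_nat_numeral)
  hence eq: "x ^ 2 + x * y + y ^ 2 = 0" using xy by simp
  have y0: "y \<noteq> 0" using eq xy by auto
  have "(2 * x + y) ^ 2 = 4 * (x ^ 2 + x * y + y ^ 2) - 3 * y ^ 2"
    by (simp add: algebra_simps power2_eq_square)
  hence "((2 * x + y) / y) ^ 2 = -3"
    using eq y0 by (simp add: power_divide)
  moreover have "(2 * x + y) / y \<in> K" using xy by (intro K_closed)
  moreover have "(3::'a) \<noteq> 0"
  proof
    assume z: "(3::'a) = 0"
    have "(x - y) ^ 3 = x ^ 3 - y ^ 3 - 3 * (x * y * (x - y))"
      by (simp add: algebra_simps eval_nat_numeral)
    hence "(x - y) ^ 3 = 0" using z xy by simp
    thus False using xy by simp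
  qed
  ultimately show ?thesis by blast
qed

lemma not_inj_if_not_in_K:
  assumes g: "\<gamma> \<notin> K"
  shows "\<not> inj (\<lambda>x. x + \<gamma> * trace_term x)"
proof -
  define E where "E = (\<gamma> - \<gamma> ^ q) ^ 2"
  have th: "\<gamma> - \<gamma> ^ q \<noteq> 0" using g by (simp add: in_K_iff)
  have E: "E \<in> K" "E \<noteq> 0" "\<chi> E = -1"
    using anti_square[OF conj_diff_conj th] th by (auto simp: E_def)
  define A0 where "A0 = (E / 2) ^ 2"
  have A0: "A0 \<in> K" "\<chi> A0 = 1"
    using E two_neq_0 by (auto simp: A0_def intro!: K_closed quad_char_square)
  have A0E: "4 * r ^ 3 + E ^ 2 = 2 ^ 2 * (r ^ 3 + A0)" for r
    using two_neq_0 four_neq_0 by (simp add: A0_def field_simps)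
  show ?thesis
  proof (cases "\<exists>r\<in>K. r ^ 3 = - A0")
    case True
    then obtain r where r: "r \<in> K" "r ^ 3 = - A0" by blast
    have r0: "r \<noteq> 0" using r A0 by auto
    show ?thesis
    proof (cases "(3::'a) = 0")
      case False
      show ?thesis
        \<comment> \<open>The discriminant vanishes at this \<open>r\<close>, so 0 is its square
          root.\<close>
        using g False r r0 K_0 A0E[of r]
        by (intro not_inj_if_square[of \<gamma> r 0]) (simp_all add: E_def)
    next
      case True
      \<comment> \<open>In characteristic 3 the choice a = 0 works: 4 = 1 turns the quadratic form
        in \<gamma> into \<open>E\<close>, and the root condition becomes r^3 = -E^2.\<close>
      define s where "s = 1 / r"
      have s: "s \<in> K" "s \<noteq> 0" using r r0 by (auto simp: s_def intro!: K_closed)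
      have "4 * (\<gamma> ^ 2 + \<gamma> * \<gamma> ^ q + (\<gamma> ^ q) ^ 2) = E + 3 * (\<gamma> + \<gamma> ^ q) ^ 2"
        by (simp add: E_def algebra_simps power2_eq_square)
      moreover have four: "(4::'a) = 1"
      proof -
        have "(4::'a) = 3 + 1" by simp
        thus ?thesis unfolding True by simp
      qed
      ultimately have M: "\<gamma> ^ 2 + \<gamma> * \<gamma> ^ q + (\<gamma> ^ q) ^ 2 = E"
        using True by simp
      have "r ^ 3 + E ^ 2 = 0" using A0E[of r] r four by simp
      hence "E ^ 2 = - (r ^ 3)" by (simp add: eq_neg_iff_add_eq_0 add.commute)
      hence "s ^ 4 * E ^ 2 = - s" using r0 by (simp add: s_def eval_nat_numeral)
      moreover have "trace_term (0 + s * \<gamma>) = s ^ 4 * E ^ 2"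
        unfolding trace_term_line[OF K_0 s(1)] M by (simp add: E_def eval_nat_numeral)
      ultimately have root: "s + trace_term (0 + s * \<gamma>) = 0" by simp
      have "\<gamma> \<noteq> 0" using g K_0 by auto
      from not_inj_if_root[OF K_0 s this root] show ?thesis .
    qed
  next
    case False
    then obtain y where y: "y \<in> K" "y ^ 2 = -3" "(3::'a) \<noteq> 0"
      using cube_surj_or_minus_3_square[of "- A0"] A0 K_uminus by blast
    have "q \<noteq> 3"
    proof
      assume "q = 3"
      hence "CHAR('a) dvd 3 ^ 2" using CHAR_dvd_CARD[where ?'a = 'a] card_q2 by simp
      hence "CHAR('a) dvd 3"
        using CHAR_prime[where ?'a = 'a] prime_dvd_power by blast
      thus False using y(3) of_nat_eq_0_iff_char_dvd[of 3, where ?'a = 'a] by simp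
    qed
    moreover have "q \<noteq> 2" using q by auto
    ultimately have "q > 3" using q_gt_1 by linarith
    then obtain r where r: "r \<in> K" "\<chi> (r ^ 3 + A0) \<noteq> 1"
      using exists_cube_plus_not_square A0 by blast
    have r0: "r \<noteq> 0" using r A0 by auto
    have nz: "r ^ 3 + A0 \<noteq> 0" using False r by (auto simp: eq_neg_iff_add_eq_0)
    \<comment> \<open>Both factors are nonsquares, so their product is a square; -3 is a square too,
      hence so is the discriminant.\<close>
    have "\<chi> (E * (r ^ 3 + A0)) = 1"
      using E A0 r nz quad_char_cases[OF nz, of q] quad_char_mult[of E "r ^ 3 + A0"]
      by (auto simp: K_closed)
    then obtain z where z: "z \<in> K" "z ^ 2 = E * (r ^ 3 + A0)"
      using square_if_quad_char[of "E * (r ^ 3 + A0)"] E A0 r by (auto simp: K_closed)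
    have "(2 * y * z) ^ 2 = -3 * E * (4 * r ^ 3 + E ^ 2)"
      unfolding A0E power_mult_distrib y(2) z(2) by (simp add: algebra_simps)
    moreover have "2 * y * z \<in> K" using y(1) z(1) by (intro K_closed)
    ultimately show ?thesis
      using g y(3) r(1) r0 by (intro not_inj_if_square[of \<gamma> r "2 * y * z"]) (simp_all add: E_def)
  qed
qed

section \<open>Parameters \<gamma> in the subfield\<close>

lemma not_inj_if_in_K:
  assumes "\<gamma> \<in> K" "\<gamma> \<noteq> 0" and three: "(3::'a) \<noteq> 0"
  shows "\<not> inj (\<lambda>x. x + \<gamma> * trace_term x)"
proof
  assume inj: "inj (\<lambda>x. x + \<gamma> * trace_term x)"
  obtain \<theta> :: 'a where th: "\<theta> ^ q = - \<theta>" "\<theta> \<noteq> 0"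
    using exists_anti by blast
  \<comment> \<open>Moving \<theta> by \<gamma>s keeps x - x^q and raises the trace by 12 \<theta>^2
    \<gamma>^2 s^2. This \<open>s\<close> makes the increase equal to -s, which offsets the
    move.\<close>
  define s where "s = - 1 / (12 * \<theta> ^ 2 * \<gamma> ^ 2)"
  have sK: "s \<in> K"
    unfolding s_def using anti_square(1)[OF th] assms(1)
    by (intro K_divide K_mult K_uminus K_1 K_numeral K_power[of \<gamma>])
  have "(3::'a) * 4 \<noteq> 0" using three four_neq_0 by (rule no_zero_divisors)
  hence twelve: "(12::'a) \<noteq> 0" by simp
  have nz: "12 * \<theta> ^ 2 * \<gamma> ^ 2 \<noteq> 0"
    using twelve th assms by simp
  have s0: "s \<noteq> 0" using nz by (simp add: s_def)
  have s12: "12 * \<theta> ^ 2 * \<gamma> ^ 2 * s = -1" unfolding s_def using nz by simp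
  have conj: "(\<theta> + \<gamma> * s) ^ q = - \<theta> + \<gamma> * s"
    using th assms sK by (simp add: conj_add power_mult_distrib conj_K)
  have "trace_term (\<theta> + \<gamma> * s) = trace_term \<theta> + s * (12 * \<theta> ^ 2 * \<gamma> ^ 2 * s)"
    unfolding trace_term_def conj th(1) by (simp add: algebra_simps eval_nat_numeral)
  hence shift: "trace_term (\<theta> + \<gamma> * s) = trace_term \<theta> - s" unfolding s12 by simp
  have "(\<theta> + \<gamma> * s) + \<gamma> * trace_term (\<theta> + \<gamma> * s) = \<theta> + \<gamma> * trace_term \<theta>"
    unfolding shift by (simp add: algebra_simps)
  hence "\<theta> + \<gamma> * s = \<theta>" by (rule injD[OF inj])
  thus False using s0 assms by simp
qed

text \<open>The trace is (x - x^q)^4, which lies in \<open>K\<close> because conjugation negates the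
  base. Points with equal images thus differ by an element of \<open>K\<close>, so they share x -
  x^q and the trace.\<close>

lemma inj_if_in_K:
  assumes "\<gamma> \<in> K" and three: "(3::'a) = 0"
  shows "inj (\<lambda>x. x + \<gamma> * trace_term x)"
proof (rule injI)
  fix x y assume eq: "x + \<gamma> * trace_term x = y + \<gamma> * trace_term y"
  have h4: "trace_term x = (x - x ^ q) ^ 4" for x
  proof -
    have "trace_term x = (x - x ^ q) ^ 4 + 3 * (x * x ^ q * (x - x ^ q) ^ 2)"
      by (simp add: trace_term_def algebra_simps eval_nat_numeral)
    thus ?thesis using three by simp
  qed
  have hK: "trace_term x \<in> K" for x
  proof -
    have "(trace_term x) ^ q = ((x - x ^ q) ^ q) ^ 4"
      by (simp only: h4 power_mult[symmetric] mult.commute[of 4])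
    also have "\<dots> = (x - x ^ q) ^ 4"
      unfolding conj_diff_conj by (rule power_minus_even) simp
    finally show ?thesis by (simp add: in_K_iff h4)
  qed
  have diff: "x - y = \<gamma> * (trace_term y - trace_term x)" using eq by (simp add: algebra_simps)
  have "x - y \<in> K" unfolding diff using assms hK by (intro K_closed)
  hence "x - x ^ q = y - y ^ q" by (simp add: in_K_iff conj_diff) (simp add: algebra_simps)
  hence "trace_term x = trace_term y" by (simp add: h4)
  thus "x = y" using eq by simp
qed

end

theorem theorem3p7:
  fixes q :: nat and \<gamma> :: "'a::finite_field" and f :: "'a poly"
  assumes "primepow q" and "odd q" and "CARD('a) = q ^ 2"
    and "f = monom 1 1 + smult \<gamma> (Tr q (monom 1 4 - monom 1 (q + 3)))"
  shows "(CHAR('a) \<noteq> 3 \<longrightarrow> (permutation_polynomial f \<longleftrightarrow> \<gamma> = 0)) \<and>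
         (CHAR('a) = 3 \<longrightarrow> (permutation_polynomial f \<longleftrightarrow> \<gamma> \<in> Fq q))"
proof -
  note c = assms(1-3)
  have "permutation_polynomial f \<longleftrightarrow> inj (poly f)"
    unfolding permutation_polynomial_def
    by (metis bij_def finite_UNIV_inj_surj finite)
  moreover have "poly f = (\<lambda>x. x + \<gamma> * trace_term q x)"
    unfolding assms(4) by (intro ext poly_eq_trace_term[OF c])
  ultimately have perm: "permutation_polynomial f \<longleftrightarrow> inj (\<lambda>x. x + \<gamma> * trace_term q x)" by simp
  have "(3::'a) = 0 \<longleftrightarrow> CHAR('a) dvd 3"
    using of_nat_eq_0_iff_char_dvd[of 3, where ?'a = 'a] by simp
  also have "\<dots> \<longleftrightarrow> CHAR('a) = 3"
    using CHAR_prime[where ?'a = 'a] primes_dvd_imp_eq[of "CHAR('a)" 3] by auto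
  finally have char: "(3::'a) = 0 \<longleftrightarrow> CHAR('a) = 3" .
  have "permutation_polynomial f \<longleftrightarrow> \<gamma> = 0" if "(3::'a) \<noteq> 0"
    using not_inj_if_not_in_K[OF c, of \<gamma>] not_inj_if_in_K[OF c, of \<gamma>] that perm by auto
  moreover have "permutation_polynomial f \<longleftrightarrow> \<gamma> \<in> Fq q" if "(3::'a) = 0"
    using not_inj_if_not_in_K[OF c, of \<gamma>] inj_if_in_K[OF c, of \<gamma>] that perm by blast
  ultimately show ?thesis using char by blast
qed

end
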